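(* For all $\beta\in[0,1]$, one has $|E_{1,\beta}(z)|\ge E_{1,\beta}(\Re z)$ for all $z\in\mathbb{C}$.
   Context: For $\beta\in\mathbb{R}$, $E_{1,\beta}$ is the Mittag-Leffler function $E_{1,\beta}(z)=\sum_{k=0}^{\infty}\frac{z^k}{\Gamma(k+\beta)}$, $z\in\mathbb{C}$, with the convention $1/\Gamma(s)=0$ at the poles $s=0,-1,-2,\dots$ of $\Gamma$. $\Re z$ denotes the real part of $z$. *)

theory Defs
  imports "HOL-Analysis.Analysis"
begin

text \<open>
  The function $E_{1,\beta}$ for real $\beta$.  The coefficients $1/\Gamma(k+\beta)$ are given by
  \<^const>\<open>rGamma\<close>, which vanishes at the poles $0,-1,-2,\dots$ of $\Gamma$.  As for \<^const>\<open>exp\<close>,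
  one definition covers real and complex arguments; the two versions agree on the reals by
  \<open>mittag_leffler1_of_real\<close> below.
\<close>

definition mittag_leffler1 :: "real \<Rightarrow> 'a \<Rightarrow> 'a::{real_normed_algebra_1,banach}" where
  "mittag_leffler1 \<beta> z = (\<Sum>k. rGamma (real k + \<beta>) *\<^sub>R z ^ k)"

lemma summable_mittag_leffler1:
  fixes z :: "'a::{real_normed_algebra_1,banach}"
  shows "summable (\<lambda>k. rGamma (real k + \<beta>) *\<^sub>R z ^ k)"
proof -
  obtain N :: nat where N: "2 * norm z + \<bar>\<beta>\<bar> + 1 \<le> real N"
    using real_arch_simple by blast
  define b where "b n = \<bar>rGamma (real n + \<beta>)\<bar> * norm z ^ n" for n
  have step: "b (Suc n) \<le> 1/2 * b n" if "n \<ge> N" for n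
  proof -
    have "real n \<ge> real N"
      using that by simp
    then have n: "real n + \<beta> > 0" "2 * norm z \<le> real n + \<beta>"
      using N norm_ge_zero[of z] by linarith+
    have "(real n + \<beta>) * rGamma (real n + \<beta> + 1) = rGamma (real n + \<beta>)"
      by (rule rGamma_plus1)
    then have "\<bar>rGamma (real n + \<beta>)\<bar> = (real n + \<beta>) * \<bar>rGamma (real (Suc n) + \<beta>)\<bar>"
      using n(1) by (metis abs_mult abs_of_pos add.commute add.left_commute of_nat_Suc)
    then have "b n = (real n + \<beta>) * (\<bar>rGamma (real (Suc n) + \<beta>)\<bar> * norm z ^ n)"
      by (simp add: b_def)
    moreover have "2 * norm z * (\<bar>rGamma (real (Suc n) + \<beta>)\<bar> * norm z ^ n) \<le>
        (real n + \<beta>) * (\<bar>rGamma (real (Suc n) + \<beta>)\<bar> * norm z ^ n)"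
      using n(2) by (intro mult_right_mono) auto
    moreover have "2 * b (Suc n) = 2 * norm z * (\<bar>rGamma (real (Suc n) + \<beta>)\<bar> * norm z ^ n)"
      by (simp add: b_def)
    ultimately show ?thesis
      by linarith
  qed
  have b_nonneg: "b n \<ge> 0" for n
    by (simp add: b_def)
  have "summable b"
  proof (rule summable_ratio_test)
    show "(1/2 :: real) < 1"
      by simp
    show "norm (b (Suc n)) \<le> 1/2 * norm (b n)" if "n \<ge> N" for n
      using step[OF that] b_nonneg by simp
  qed
  moreover have "norm (rGamma (real n + \<beta>) *\<^sub>R z ^ n) \<le> b n" for n
    by (simp add: b_def mult_left_mono norm_power_ineq)
  ultimately show ?thesis
    by (rule summable_comparison_test')
qed

lemma mittag_leffler1_of_real:
  "mittag_leffler1 \<beta> (of_real x :: 'a::{real_normed_algebra_1,banach}) =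
     of_real (mittag_leffler1 \<beta> x)"
proof -
  have "(\<lambda>k. rGamma (real k + \<beta>) *\<^sub>R x ^ k) sums mittag_leffler1 \<beta> x"
    unfolding mittag_leffler1_def by (rule summable_sums[OF summable_mittag_leffler1])
  then have "(\<lambda>k. of_real (rGamma (real k + \<beta>) *\<^sub>R x ^ k) :: 'a) sums
      of_real (mittag_leffler1 \<beta> x)"
    by (rule sums_of_real)
  then show ?thesis
    unfolding mittag_leffler1_def
    by (simp add: sums_iff scaleR_conv_of_real)
qed

end

theory Submission
  imports Defs
begin

text \<open>
  Put $g(w) = e^{-w} E_{1,\beta}(w)$.  Since $|E_{1,\beta}(z)| = e^{\Re z} |g(z)|$, it suffices that
  $\Re g(z) \ge g(\Re z)$.  The function $g$ solves
  $w g'(w) - (1-\beta) g(w) = -(1-\beta) e^{-w} / \Gamma(\beta)$, so along the rays through $z$ and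
  $x = \Re z$ the difference
  $\varphi(t) = t^{\beta-1}\,(\Re g(tz) - g(tx))$ has derivative
  $(1-\beta)\, t^{\beta-2} e^{-tx} (1 - \cos (t \Im z)) / \Gamma(\beta) \ge 0$ on $(0,1]$.
  As $g'(0)$ is real, $\varphi(t) \to 0$ for $t \to 0^+$, and hence $\varphi(1) \ge 0$.
\<close>

lemma mittag_leffler1_sums:
  fixes z :: "'a::{real_normed_algebra_1,banach}"
  shows "(\<lambda>k. rGamma (real k + \<beta>) *\<^sub>R z ^ k) sums mittag_leffler1 \<beta> z"
  unfolding mittag_leffler1_def by (rule summable_sums[OF summable_mittag_leffler1])

text \<open>Splitting off the term k = 0 and reindexing. This later removes the parameter
  \<open>\<beta> - 1\<close> from the derivative formula, leaving an equation in one unknown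
  function.\<close>

lemma mittag_leffler1_shift:
  fixes z :: "'a::{real_normed_field,banach}"
  shows "mittag_leffler1 (\<beta> - 1) z = of_real (rGamma (\<beta> - 1)) + z * mittag_leffler1 \<beta> z"
proof -
  have "(\<lambda>k. z * (rGamma (real k + \<beta>) *\<^sub>R z ^ k)) sums (z * mittag_leffler1 \<beta> z)"
    by (intro sums_mult mittag_leffler1_sums)
  then have "(\<lambda>k. rGamma (real (Suc k) + (\<beta> - 1)) *\<^sub>R z ^ Suc k) sums (z * mittag_leffler1 \<beta> z)"
    by (simp add: add.commute)
  from sums_Suc[OF this] show ?thesis
    using mittag_leffler1_sums[of "\<beta> - 1" z]
    by (simp add: sums_iff of_real_def add.commute)
qed

lemma mittag_leffler1_powser:
  fixes z :: "'a::{real_normed_field,banach}"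
  shows "mittag_leffler1 \<beta> z = (\<Sum>k. of_real (rGamma (real k + \<beta>)) * z ^ k)"
  by (simp add: mittag_leffler1_def scaleR_conv_of_real)

text \<open>Termwise, z d/dz multiplies the k-th coefficient by k, and (k + \<beta> - 1)/\<Gamma>(k
  + \<beta>) = 1/\<Gamma>(k + \<beta> - 1). The value at 0 is recorded separately because the
  equation for \<open>z * E'\<close> carries no information there.\<close>

lemma DERIV_mittag_leffler1:
  fixes z :: "'a::{real_normed_field,banach}"
  obtains E' where "(mittag_leffler1 \<beta> has_field_derivative E') (at z)"
    and "z * E' = mittag_leffler1 (\<beta> - 1) z - of_real (\<beta> - 1) * mittag_leffler1 \<beta> z"
    and "z = 0 \<Longrightarrow> E' = of_real (rGamma (1 + \<beta>))"
proof
  define c where "c k = (of_real (rGamma (real k + \<beta>)) :: 'a)" for k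
  define E' where "E' = (\<Sum>k. diffs c k * z ^ k)"
  have c: "summable (\<lambda>k. c k * w ^ k)" for w
    using summable_mittag_leffler1[of \<beta> w] by (simp add: c_def scaleR_conv_of_real)
  have E: "mittag_leffler1 \<beta> = (\<lambda>w. \<Sum>k. c k * w ^ k)"
    by (simp add: fun_eq_iff c_def mittag_leffler1_powser)
  show "(mittag_leffler1 \<beta> has_field_derivative E') (at z)"
    unfolding E E'_def by (rule termdiffs_strong_converges_everywhere[OF c])
  show "E' = of_real (rGamma (1 + \<beta>))" if "z = 0"
    by (simp add: E'_def that diffs_def c_def)
  have "(\<lambda>k. diffs c k * z ^ k) sums E'"
    unfolding E'_def by (intro summable_sums termdiff_converges_all c)
  from sums_mult[OF this, of z]
  have "(\<lambda>k. of_nat (Suc k) * c (Suc k) * z ^ Suc k) sums (z * E')"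
    by (simp add: diffs_def mult_ac)
  \<comment> \<open>The restored term k = 0 carries the factor k, so the sum is unchanged.\<close>
  from sums_Suc[OF this]
  have "(\<lambda>k. of_nat k * c k * z ^ k) sums (z * E')"
    by simp
  moreover have "(\<lambda>k. of_real (\<beta> - 1) * (c k * z ^ k)) sums (of_real (\<beta> - 1) * mittag_leffler1 \<beta> z)"
    using mittag_leffler1_sums[of \<beta> z]
    by (intro sums_mult) (simp add: c_def scaleR_conv_of_real)
  ultimately have "(\<lambda>k. of_nat k * c k * z ^ k + of_real (\<beta> - 1) * (c k * z ^ k)) sums
      (z * E' + of_real (\<beta> - 1) * mittag_leffler1 \<beta> z)"
    by (rule sums_add)
  moreover have "of_nat k * c k * z ^ k + of_real (\<beta> - 1) * (c k * z ^ k) =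
      rGamma (real k + (\<beta> - 1)) *\<^sub>R z ^ k" for k
  proof -
    \<comment> \<open>For the reciprocal Gamma function this recurrence has no exceptional points,
      so poles of \<Gamma> (as for \<beta> = 0) need no separate case.\<close>
    have "rGamma (real k + (\<beta> - 1)) = (real k + (\<beta> - 1)) * rGamma (real k + \<beta>)"
      using rGamma_plus1[of "real k + (\<beta> - 1)"] by (simp add: algebra_simps)
    then have "of_real (rGamma (real k + (\<beta> - 1))) = (of_nat k + of_real (\<beta> - 1)) * c k"
      by (simp only: c_def of_real_mult of_real_add of_real_of_nat_eq)
    then show ?thesis
      by (simp only: scaleR_conv_of_real ring_distribs mult.assoc)
  qed
  ultimately show "z * E' = mittag_leffler1 (\<beta> - 1) z - of_real (\<beta> - 1) * mittag_leffler1 \<beta> z"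
    using mittag_leffler1_sums[of "\<beta> - 1" z] by (simp add: sums_iff algebra_simps)
qed

text \<open>By the shift identity \<open>z * E'\<close> contains the summand z E(z); differentiating
  the factor e^(-z) cancels exactly this summand. What remains is a first-order linear equation with
  an explicit inhomogeneity.\<close>

lemma DERIV_exp_mittag_leffler1:
  fixes z :: "'a::{real_normed_field,banach}"
  obtains g' where
    "((\<lambda>w. exp (- w) * mittag_leffler1 \<beta> w) has_field_derivative g') (at z)"
    and "z * g' = of_real (1 - \<beta>) * (exp (- z) * mittag_leffler1 \<beta> z)
           - of_real ((1 - \<beta>) * rGamma \<beta>) * exp (- z)"
    and "z = 0 \<Longrightarrow> g' = of_real (rGamma (1 + \<beta>) - rGamma \<beta>)"
proof -
  from DERIV_mittag_leffler1[of \<beta> z] obtain E' where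
    d: "(mittag_leffler1 \<beta> has_field_derivative E') (at z)" and
    ode: "z * E' = mittag_leffler1 (\<beta> - 1) z - of_real (\<beta> - 1) * mittag_leffler1 \<beta> z" and
    at0: "z = 0 \<Longrightarrow> E' = of_real (rGamma (1 + \<beta>))"
    by blast
  show thesis
  proof
    show "((\<lambda>w. exp (- w) * mittag_leffler1 \<beta> w) has_field_derivative
        exp (- z) * (E' - mittag_leffler1 \<beta> z)) (at z)"
      by (auto intro!: derivative_eq_intros d simp: algebra_simps)
    have "rGamma (\<beta> - 1) = (\<beta> - 1) * rGamma \<beta>"
      using rGamma_plus1[of "\<beta> - 1"] by simp
    then have "z * (E' - mittag_leffler1 \<beta> z) =
        of_real (1 - \<beta>) * mittag_leffler1 \<beta> z - of_real ((1 - \<beta>) * rGamma \<beta>)"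
      by (simp add: right_diff_distrib ode mittag_leffler1_shift) (simp add: algebra_simps)
    then have "exp (- z) * (z * (E' - mittag_leffler1 \<beta> z)) =
        exp (- z) * (of_real (1 - \<beta>) * mittag_leffler1 \<beta> z - of_real ((1 - \<beta>) * rGamma \<beta>))"
      by simp
    then show "z * (exp (- z) * (E' - mittag_leffler1 \<beta> z)) =
        of_real (1 - \<beta>) * (exp (- z) * mittag_leffler1 \<beta> z)
          - of_real ((1 - \<beta>) * rGamma \<beta>) * exp (- z)"
      by (simp add: algebra_simps)
    show "exp (- z) * (E' - mittag_leffler1 \<beta> z) = of_real (rGamma (1 + \<beta>) - rGamma \<beta>)"
      if "z = 0"
      using that at0 by (simp add: mittag_leffler1_powser)
  qed
qed

text \<open>Turns complex differentiability into a real derivative along a ray, so that monotonicity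
  arguments on the real line become available.\<close>

lemma DERIV_Re_ray:
  assumes "(g has_field_derivative g') (at (of_real t * z))"
  shows "((\<lambda>s. Re (g (of_real s * z))) has_field_derivative Re (z * g')) (at t)"
proof -
  have "((\<lambda>w. g (w * z)) has_field_derivative g' * z) (at (of_real t))"
    by (rule DERIV_chain2[where f = g and g = "\<lambda>w. w * z", OF assms]) (auto intro!: derivative_eq_intros)
  then show ?thesis
    by (intro has_field_derivative_Re has_vector_derivative_real_field) (simp add: mult.commute)
qed

lemma Re_exp_mittag_leffler1_ge:
  fixes \<beta> :: real and z :: complex
  assumes \<beta>: "\<beta> \<in> {0..1}"
  defines "g \<equiv> \<lambda>w. exp (- w) * mittag_leffler1 \<beta> w"
  shows "Re (g (of_real (Re z))) \<le> Re (g z)"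
proof -
  define x where "x = Re z"
  define D where "D t = Re (g (of_real t * z)) - Re (g (of_real t * of_real x))" for t
  define \<phi> where "\<phi> t = t powr (\<beta> - 1) * D t" for t
  \<comment> \<open>At \<beta> = 0 the value is 0 by the pole convention; otherwise \<Gamma> is
    positive.\<close>
  have r: "rGamma \<beta> \<ge> 0"
    using \<beta> Gamma_real_pos[of \<beta>] by (cases "\<beta> = 0") (auto simp: rGamma_inverse_Gamma)
  have \<phi>': "\<exists>d\<ge>0. (\<phi> has_field_derivative d) (at t)" if t: "t > 0" for t
  proof -
    have ray: "\<exists>d. ((\<lambda>s. Re (g (of_real s * w))) has_field_derivative d) (at t) \<and>
        t * d = (1 - \<beta>) * Re (g (of_real t * w)) - (1 - \<beta>) * rGamma \<beta> * Re (exp (- (of_real t * w)))"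
      for w
    proof -
      obtain g' where g': "(g has_field_derivative g') (at (of_real t * w))"
        and ode: "of_real t * w * g' = of_real (1 - \<beta>) * g (of_real t * w)
           - of_real ((1 - \<beta>) * rGamma \<beta>) * exp (- (of_real t * w))"
        unfolding g_def using DERIV_exp_mittag_leffler1[of \<beta> "of_real t * w"] by blast
      have "t * Re (w * g') = Re (of_real t * w * g')"
        by (simp add: algebra_simps)
      then have "t * Re (w * g') = Re (of_real (1 - \<beta>) * g (of_real t * w)
           - of_real ((1 - \<beta>) * rGamma \<beta>) * exp (- (of_real t * w)))"
        by (simp only: ode)
      then show ?thesis
        using DERIV_Re_ray[OF g'] by (intro exI[of _ "Re (w * g')"]) (simp del: of_real_mult of_real_diff)
    qed
    from ray[of z] ray[of "of_real x"] obtain d e where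
      d: "((\<lambda>s. Re (g (of_real s * z))) has_field_derivative d) (at t)"
         "t * d = (1 - \<beta>) * Re (g (of_real t * z))
            - (1 - \<beta>) * rGamma \<beta> * Re (exp (- (of_real t * z)))" and
      e: "((\<lambda>s. Re (g (of_real s * of_real x))) has_field_derivative e) (at t)"
         "t * e = (1 - \<beta>) * Re (g (of_real t * of_real x))
            - (1 - \<beta>) * rGamma \<beta> * Re (exp (- (of_real t * of_real x)))"
      by blast
    have D': "(D has_field_derivative (d - e)) (at t)"
      unfolding D_def by (intro DERIV_diff d e)
    \<comment> \<open>The left side is e^(-tx) cos(t Im z), the right side e^(-tx). This is where
      the inhomogeneities on the two rays are compared.\<close>
    have "Re (exp (- (of_real t * z))) \<le> Re (exp (- (of_real t * of_real x)))"
      by (simp add: Re_exp x_def)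
    then have "(1 - \<beta>) * rGamma \<beta> * Re (exp (- (of_real t * z))) \<le>
        (1 - \<beta>) * rGamma \<beta> * Re (exp (- (of_real t * of_real x)))"
      using r \<beta> by (intro mult_left_mono) auto
    moreover have "t * (d - e) + (\<beta> - 1) * D t =
      (1 - \<beta>) * rGamma \<beta> * Re (exp (- (of_real t * of_real x)))
      - (1 - \<beta>) * rGamma \<beta> * Re (exp (- (of_real t * z)))"
      unfolding right_diff_distrib d(2) e(2) D_def by (simp add: left_diff_distrib)
    ultimately have nonneg: "t * (d - e) + (\<beta> - 1) * D t \<ge> 0"
      by linarith
    \<comment> \<open>The power \<open>t powr (\<beta> - 1)\<close> is the integrating factor:
      pulling out \<open>t powr (\<beta> - 2)\<close> leaves exactly the expression in
      \<open>nonneg\<close>.\<close>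
    have "(\<phi> has_field_derivative
        (\<beta> - 1) * t powr (\<beta> - 1 - 1) * D t + (d - e) * t powr (\<beta> - 1)) (at t)"
      unfolding \<phi>_def using t by (intro DERIV_mult has_real_derivative_powr D')
    also have "t powr (\<beta> - 1) = t * t powr (\<beta> - 1 - 1)"
      using powr_mult_base[of t "\<beta> - 1 - 1"] t by simp
    also have "(\<beta> - 1) * t powr (\<beta> - 1 - 1) * D t + (d - e) * (t * t powr (\<beta> - 1 - 1)) =
        t powr (\<beta> - 1 - 1) * (t * (d - e) + (\<beta> - 1) * D t)"
      by (simp only: ring_distribs mult_ac add_ac)
    finally have "(\<phi> has_field_derivative
        t powr (\<beta> - 1 - 1) * (t * (d - e) + (\<beta> - 1) * D t)) (at t)" .
    moreover have "t powr (\<beta> - 1 - 1) * (t * (d - e) + (\<beta> - 1) * D t) \<ge> 0"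
      by (intro mult_nonneg_nonneg nonneg) simp
    ultimately show ?thesis
      by blast
  qed
  have mono: "\<phi> s \<le> \<phi> 1" if "0 < s" "s \<le> 1" for s
  proof (rule DERIV_nonneg_imp_nondecreasing[OF that(2)])
    fix t assume "s \<le> t"
    then have "t > 0"
      using that by simp
    from \<phi>'[OF this] show "\<exists>d. (\<phi> has_field_derivative d) (at t) \<and> d \<ge> 0"
      by blast
  qed
  \<comment> \<open>Since g'(0) is real, the slope at 0 along the ray through w depends only on Re
    w, which is the same for z and x.\<close>
  have "(D has_field_derivative 0) (at 0)"
  proof -
    obtain g' where "(g has_field_derivative g') (at 0)"
      and "g' = of_real (rGamma (1 + \<beta>) - rGamma \<beta>)"
      unfolding g_def using DERIV_exp_mittag_leffler1[of \<beta> 0] by blast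
    then have ray: "((\<lambda>s. Re (g (of_real s * w))) has_field_derivative
        Re w * (rGamma (1 + \<beta>) - rGamma \<beta>)) (at 0)" for w
      using DERIV_Re_ray[of g g' 0 w] by simp
    show ?thesis
      using DERIV_diff[OF ray[of z] ray[of "of_real x"]] unfolding D_def by (simp add: x_def)
  qed
  moreover have "D 0 = 0"
    by (simp add: D_def)
  ultimately have "(\<lambda>t. D t / t) \<midarrow>0\<rightarrow> 0"
    by (simp add: DERIV_def)
  then have lim: "((\<lambda>t. D t / t) \<longlongrightarrow> 0) (at_right 0)"
    by (rule filterlim_mono) (auto simp: at_le)
  \<comment> \<open>Here |\<phi>(t)| = t^\<beta> |D(t)/t|. The quotient tends to D'(0) = 0, and
    t^\<beta> \<le> 1 on (0,1) because \<beta> \<ge> 0; so the singular weight is harmless even for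
    \<beta> = 0.\<close>
  have "(\<phi> \<longlongrightarrow> 0) (at_right 0)"
  proof (rule Lim_null_comparison)
    show "((\<lambda>t. \<bar>D t / t\<bar>) \<longlongrightarrow> 0) (at_right 0)"
      using lim by (rule tendsto_rabs_zero)
    have "\<forall>\<^sub>F t in at_right (0::real). t \<in> {0<..<1}"
      by (rule eventually_at_right_real) simp
    then show "\<forall>\<^sub>F t in at_right 0. norm (\<phi> t) \<le> \<bar>D t / t\<bar>"
    proof eventually_elim
      case (elim t)
      have "t powr \<beta> \<le> 1"
        using \<beta> elim by (intro powr_le1) auto
      then have "t powr \<beta> * \<bar>D t / t\<bar> \<le> 1 * \<bar>D t / t\<bar>"
        by (intro mult_right_mono) auto
      moreover have "norm (\<phi> t) = t powr \<beta> * \<bar>D t / t\<bar>"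
        using elim by (simp add: \<phi>_def powr_diff abs_mult)
      ultimately show ?case
        by simp
    qed
  qed
  \<comment> \<open>The monotonicity is available only on positive t, so the limit from the right
    takes the place of a value at 0.\<close>
  moreover have "\<forall>\<^sub>F t in at_right 0. \<phi> t \<le> \<phi> 1"
    using eventually_at_right_real[OF zero_less_one] by eventually_elim (auto intro: mono)
  ultimately have "0 \<le> \<phi> 1"
    by (intro tendsto_upperbound[where F = "at_right 0"]) auto
  then show ?thesis
    by (simp add: \<phi>_def D_def x_def)
qed

theorem corollary5:
  fixes \<beta> :: real and z :: complex
  assumes "\<beta> \<in> {0..1}"
  shows "cmod (mittag_leffler1 \<beta> z) \<ge> mittag_leffler1 \<beta> (Re z)"
proof -
  let ?E = "mittag_leffler1 \<beta> :: complex \<Rightarrow> complex"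
  \<comment> \<open>Both sides are scaled by e^(-Re z), which is |e^(-z)|; being positive, it
    cancels at the end.\<close>
  have "exp (- Re z) * mittag_leffler1 \<beta> (Re z) = Re (exp (- of_real (Re z)) * ?E (of_real (Re z)))"
    by (simp add: mittag_leffler1_of_real Re_exp Im_exp)
  also have "\<dots> \<le> Re (exp (- z) * ?E z)"
    using assms by (rule Re_exp_mittag_leffler1_ge)
  also have "\<dots> \<le> cmod (exp (- z) * ?E z)"
    by (rule complex_Re_le_cmod)
  also have "\<dots> = exp (- Re z) * cmod (?E z)"
    by (simp add: norm_mult)
  finally show ?thesis
    by simp
qed

end
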